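(* Let $0<\alpha<1$ and $m\ge 1$. Let $\mathcal D_{\mathrm{dev}}$ be development information, let $H_1,\dots,H_m$ be calibration documents and $X$ a new null document (each augmented with its own random seed if scoring is randomized), and suppose that, conditional on $\mathcal D_{\mathrm{dev}}$, the $m+1$ (augmented) documents $H_1,\dots,H_m,X$ are exchangeable. Let $\mathcal A$ be a finite family of actions, let $(S_a)_{a\in\mathcal A}$ be measurable score maps with values in the extended real line, and let $(w_a)_{a\in\mathcal A}$ be weights with $w_a\ge 0$ and $\sum_{a\in\mathcal A}w_a\le 1$, all fixed using $\mathcal D_{\mathrm{dev}}$. Put $\alpha_a=\alpha w_a$ and $$p_a(X)=\frac{1+\sum_{i=1}^m\mathbf 1\{S_a(H_i)\ge S_a(X)\}}{m+1},\qquad a\in\mathcal A .$$ Let $\mathcal E\subseteq\mathcal A$ be the (random) subset of executed actions, chosen together with its execution order by any measurable rule, which may depend on the observed scores or ranks. An alert occurs if and only if some executed action $a\in\mathcal E$ satisfies $p_a(X)\le\alpha_a$. Then, with no restriction on the dependence between the scores of different actions, $$\mathbb P_0\{\text{an alert occurs at any executed action}\}\le\alpha .$$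
   Context: A document $X=(W_1,\dots,W_L)$ is a random element (a finite token sequence, including its length $L$ and acquisition metadata) of a measurable space; no assumption is made on dependence between tokens within a document. An action is a pair $a=(k,j)$ where $k$ indexes a token budget $b_k$ and $j$ a detector; $S_a(X)$ is computed from the first $\min(b_k,L)$ tokens by a fixed map, with larger scores indicating greater suspicion; it is defined on all documents (whether or not the action is executed), and the same truncation and failure rules apply to calibration and test documents (for example a failure may be scored $-\infty$). "Fixed using $\mathcal D_{\mathrm{dev}}$" means that, conditional on $\mathcal D_{\mathrm{dev}}$, the action family, score maps and weights are deterministic; in particular they do not depend on the calibration or test documents. Per-document randomization is applied symmetrically: each document is augmented with its own seed (e.g. independent seeds from a common distribution, independent of the documents) and the same fixed map is applied to all augmented documents; a revisited action reuses its realized score. $\mathbb P_0$ denotes the joint null experiment, including the development information, the calibration documents, the new null document and all algorithmic randomness. *)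

theory Defs
  imports "HOL-Probability.Probability"
begin

text \<open>An action \<open>(k, j)\<close> pairs the index of a token budget with the index of a detector.\<close>

type_synonym action = "nat \<times> nat"

text \<open>A document is its token sequence together with acquisition metadata; the length \<open>L\<close> is
  the length of the list. An augmented document also carries its own seed. For deterministic
  scoring take \<open>'seed = unit\<close>.\<close>

type_synonym ('tok, 'meta) doc = "'tok list \<times> 'meta"
type_synonym ('tok, 'meta, 'seed) aug_doc = "('tok, 'meta) doc \<times> 'seed"

text \<open>The score map of an action sees only the first \<open>min b\<^sub>k L\<close> tokens (and the metadata and the
  seed); \<open>take n ts\<close> is all of \<open>ts\<close> when \<open>n\<close> exceeds its length.
  Failures may be scored by any extended real, for example \<open>-\<infinity>\<close>.\<close>

definition score ::
  "(nat \<Rightarrow> nat) \<Rightarrow> (action \<Rightarrow> 'tok list \<Rightarrow> 'meta \<Rightarrow> 'seed \<Rightarrow> ereal)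
     \<Rightarrow> action \<Rightarrow> ('tok, 'meta, 'seed) aug_doc \<Rightarrow> ereal" where
  "score b g a z = g a (take (b (fst a)) (fst (fst z))) (snd (fst z)) (snd z)"

definition cond_prob_given ::
  "'w measure \<Rightarrow> 'd measure \<Rightarrow> ('w \<Rightarrow> 'd) \<Rightarrow> 'w set \<Rightarrow> 'w \<Rightarrow> real" where
  "cond_prob_given M DS D E = real_cond_exp M (vimage_algebra (space M) D DS) (indicator E)"

text \<open>Conditionally on \<open>D\<close>, every permutation of the family \<open>(Z i)\<close>, \<open>i \<in> I\<close>, has the same joint
  law as the family itself. The conditional laws are compared event by event, so that no regular
  conditional distribution has to exist.\<close>

definition cond_exchangeable ::
  "'w measure \<Rightarrow> 'd measure \<Rightarrow> ('w \<Rightarrow> 'd) \<Rightarrow> 'i set \<Rightarrow> 'z measure \<Rightarrow> ('i \<Rightarrow> 'w \<Rightarrow> 'z) \<Rightarrow> bool"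
  where
  "cond_exchangeable M DS D I N Z \<longleftrightarrow>
     (\<forall>\<pi>. \<pi> permutes I \<longrightarrow>
       (\<forall>B \<in> sets (PiM I (\<lambda>_. N)).
         AE \<omega> in M.
           cond_prob_given M DS D {\<omega>' \<in> space M. (\<lambda>i\<in>I. Z (\<pi> i) \<omega>') \<in> B} \<omega>
         = cond_prob_given M DS D {\<omega>' \<in> space M. (\<lambda>i\<in>I. Z i \<omega>') \<in> B} \<omega>))"

text \<open>The new document sits at index 0, the calibration documents at indices \<open>1, \<dots>, m\<close>.\<close>

definition pooled :: "(nat \<Rightarrow> 'w \<Rightarrow> 'z) \<Rightarrow> ('w \<Rightarrow> 'z) \<Rightarrow> nat \<Rightarrow> 'w \<Rightarrow> 'z" where
  "pooled H X i = (if i = 0 then X else H i)"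

definition conformal_p :: "nat \<Rightarrow> ('z \<Rightarrow> ereal) \<Rightarrow> (nat \<Rightarrow> 'z) \<Rightarrow> 'z \<Rightarrow> real" where
  "conformal_p m s h x = (1 + (\<Sum>i=1..m. of_bool (s (h i) \<ge> s x))) / (real m + 1)"

end

theory Submission imports Defs begin

text \<open>
  Conditional exchangeability makes the joint law of the development information and the \<open>m + 1\<close>
  documents invariant under permutations of the documents. So for a fixed action the event that
  document \<open>j\<close> has rank at most \<open>(m + 1) u\<close>, with \<open>u\<close> a function of the development information,
  has the same probability for every \<open>j\<close>, while pointwise at most \<open>(m + 1) u\<close> documents have
  such a rank. Averaging bounds the probability that \<open>p\<^sub>a \<le> \<alpha> w\<^sub>a\<close> by the expectation of
  \<open>\<alpha> w\<^sub>a\<close>. Whatever the execution rule, an alert implies \<open>p\<^sub>a \<le> \<alpha> w\<^sub>a\<close> for some action \<open>a\<close> of the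
  family, so a union bound finishes. As the family is itself random, the union runs over all of
  the countably many actions, each event being restricted to the actions that are in the family.
\<close>

text \<open>The lowest-scored index among those of rank at most \<open>t\<close> counts all the
  others in its own rank. Counting with \<open>\<ge>\<close> makes this survive ties: tied indices
  all receive the largest rank of their block.\<close>

lemma card_small_rank_le:
  fixes s :: "'i \<Rightarrow> 'b::linorder"
  assumes fin: "finite I" and t: "0 \<le> t"
  shows "real (card {j\<in>I. real (card {i\<in>I. s i \<ge> s j}) \<le> t}) \<le> t"
proof (cases "{j\<in>I. real (card {i\<in>I. s i \<ge> s j}) \<le> t} = {}")
  case True
  then show ?thesis using t by (metis card.empty of_nat_0)
next
  case False
  let ?J = "{j\<in>I. real (card {i\<in>I. s i \<ge> s j}) \<le> t}"
  have "finite ?J" using fin by simp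
  \<comment> \<open>Since \<open>s k\<close> is minimal on the set, the set lies inside the one
    whose cardinality is the rank of \<open>k\<close>.\<close>
  then obtain k where k: "k \<in> ?J" "\<And>j. j \<in> ?J \<Longrightarrow> s k \<le> s j"
    using False by (metis (no_types, lifting) arg_min_if_finite(1) arg_min_least)
  have "card ?J \<le> card {i\<in>I. s i \<ge> s k}"
    using k fin by (intro card_mono) auto
  also have "real \<dots> \<le> t" using k(1) by simp
  finally show ?thesis by simp
qed

text \<open>Turns the almost sure statement about conditional probabilities into one about laws.
  Integrating it over an event \<open>D \<in> C\<close> gives equality on rectangles
  \<open>C \<times> B\<close>, and these form an intersection-stable generator of the product
  sigma-algebra.\<close>

lemma cond_exchangeable_joint_law:
  fixes D :: "'w \<Rightarrow> 'd" and Z :: "'i \<Rightarrow> 'w \<Rightarrow> 'z"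
  assumes "prob_space M" and D: "D \<in> M \<rightarrow>\<^sub>M DS"
    and Z: "\<And>i. i \<in> I \<Longrightarrow> Z i \<in> M \<rightarrow>\<^sub>M N"
    and ex: "cond_exchangeable M DS D I N Z" and \<pi>: "\<pi> permutes I"
  shows "distr M (DS \<Otimes>\<^sub>M PiM I (\<lambda>_. N)) (\<lambda>\<omega>. (D \<omega>, \<lambda>i\<in>I. Z (\<pi> i) \<omega>))
       = distr M (DS \<Otimes>\<^sub>M PiM I (\<lambda>_. N)) (\<lambda>\<omega>. (D \<omega>, \<lambda>i\<in>I. Z i \<omega>))"
    (is "distr M ?P ?f = distr M ?P ?g")
proof -
  interpret prob_space M by fact
  let ?Q = "PiM I (\<lambda>_. N)"
  let ?F = "vimage_algebra (space M) D DS"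
  have Z'[measurable]: "(\<lambda>\<omega>. \<lambda>i\<in>I. Z (\<rho> i) \<omega>) \<in> M \<rightarrow>\<^sub>M ?Q" if "\<rho> permutes I" for \<rho>
    using that Z permutes_in_image[OF that] by (intro measurable_restrict) auto
  note [measurable] = Z'[OF \<pi>] Z'[OF permutes_id, unfolded id_apply] D
  have sub: "subalgebra M ?F"
    unfolding subalgebra_def
    using D by (auto simp: sets_vimage_algebra measurable_space intro!: sigma_sets_le_sets_iff[THEN iffD2])
  interpret F: finite_measure_subalgebra M ?F
    by unfold_locales (fact sub)
  have rect: "emeasure M (D -` C \<inter> space M \<inter> {\<omega>\<in>space M. (\<lambda>i\<in>I. Z (\<pi> i) \<omega>) \<in> B})
      = emeasure M (D -` C \<inter> space M \<inter> {\<omega>\<in>space M. (\<lambda>i\<in>I. Z i \<omega>) \<in> B})"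
    if C: "C \<in> sets DS" and B: "B \<in> sets ?Q" for C B
  proof -
    let ?D = "D -` C \<inter> space M"
    let ?U = "{\<omega>\<in>space M. (\<lambda>i\<in>I. Z (\<pi> i) \<omega>) \<in> B}"
    let ?V = "{\<omega>\<in>space M. (\<lambda>i\<in>I. Z i \<omega>) \<in> B}"
    have [measurable]: "?U \<in> sets M" "?V \<in> sets M" using B by measurable
    have DF: "?D \<in> sets ?F" using C by (rule in_vimage_algebra)
    have [measurable]: "?D \<in> sets M" using C by measurable
    have [measurable]: "cond_prob_given M DS D W \<in> borel_measurable M" for W
      unfolding cond_prob_given_def by (rule borel_measurable_cond_exp2)
    \<comment> \<open>The defining property of conditional expectation, applicable because
      \<open>?D\<close> lies in the sigma-algebra generated by \<open>D\<close>.\<close>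
    have *: "measure M (?D \<inter> W) = (\<integral>\<omega>\<in>?D. cond_prob_given M DS D W \<omega> \<partial>M)"
      if [measurable]: "W \<in> sets M" for W
    proof -
      have "measure M (?D \<inter> W) = (\<integral>\<omega>\<in>?D. indicator W \<omega> \<partial>M)"
        unfolding set_lebesgue_integral_def
        by (simp flip: indicator_inter_arith add: Int_assoc)
      also have "\<dots> = (\<integral>\<omega>\<in>?D. cond_prob_given M DS D W \<omega> \<partial>M)"
        unfolding cond_prob_given_def
        by (rule F.real_cond_exp_intA[OF _ DF]) (simp add: integrable_indicator_iff less_top[symmetric])
      finally show ?thesis .
    qed
    have "AE \<omega> in M. cond_prob_given M DS D ?U \<omega> = cond_prob_given M DS D ?V \<omega>"
      using ex \<pi> B unfolding cond_exchangeable_def by blast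
    then have "(\<integral>\<omega>\<in>?D. cond_prob_given M DS D ?U \<omega> \<partial>M) = (\<integral>\<omega>\<in>?D. cond_prob_given M DS D ?V \<omega> \<partial>M)"
      unfolding set_lebesgue_integral_def
      by (intro integral_cong_AE; measurable; auto)
    then show ?thesis by (simp add: * emeasure_eq_measure)
  qed
  show ?thesis
  proof (rule measure_eqI_generator_eq)
    let ?E = "{C \<times> B | C B. C \<in> sets DS \<and> B \<in> sets ?Q}"
    show "Int_stable ?E" by (rule Int_stable_pair_measure_generator)
    show "?E \<subseteq> Pow (space DS \<times> space ?Q)" by (rule pair_measure_closed)
    show "sets (distr M ?P ?f) = sigma_sets (space DS \<times> space ?Q) ?E"
      "sets (distr M ?P ?g) = sigma_sets (space DS \<times> space ?Q) ?E"
      by (simp_all add: sets_pair_measure)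
    \<comment> \<open>The uniqueness theorem wants a countable cover by generator sets of finite
      measure; the whole space is itself a rectangle, so a constant sequence serves.\<close>
    show "range (\<lambda>_::nat. space DS \<times> space ?Q) \<subseteq> ?E" by auto
    show "(\<Union>i::nat. space DS \<times> space ?Q) = space DS \<times> space ?Q" by simp
    interpret f: prob_space "distr M ?P ?f" by (rule prob_space_distr) measurable
    show "emeasure (distr M ?P ?f) (space DS \<times> space ?Q) \<noteq> \<infinity>" by (rule f.emeasure_finite[unfolded infinity_ennreal_def[symmetric]])
    fix Y assume "Y \<in> ?E"
    then obtain C B where Y: "Y = C \<times> B" "C \<in> sets DS" "B \<in> sets ?Q" by auto
    have "?f -` Y \<inter> space M = D -` C \<inter> space M \<inter> {\<omega>\<in>space M. (\<lambda>i\<in>I. Z (\<pi> i) \<omega>) \<in> B}"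
      "?g -` Y \<inter> space M = D -` C \<inter> space M \<inter> {\<omega>\<in>space M. (\<lambda>i\<in>I. Z i \<omega>) \<in> B}"
      using Y by auto
    with rect[OF Y(2,3)] Y show "emeasure (distr M ?P ?f) Y = emeasure (distr M ?P ?g) Y"
      by (simp add: emeasure_distr)
  qed
qed

text \<open>The single-action bound. \<open>C\<close> will be the event that the action belongs to
  the family, which is where its weight is known to be nonnegative. The bound stays an expectation
  so that the actions can be summed before the pointwise constraint on the weights is used.\<close>

lemma exchangeable_rank_bound:
  fixes D :: "'w \<Rightarrow> 'd" and Z :: "'i \<Rightarrow> 'w \<Rightarrow> 'z" and S :: "'d \<Rightarrow> 'z \<Rightarrow> ereal"
  assumes M: "prob_space M" and D: "D \<in> M \<rightarrow>\<^sub>M DS"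
    and Z: "\<And>i. i \<in> I \<Longrightarrow> Z i \<in> M \<rightarrow>\<^sub>M N"
    and ex: "cond_exchangeable M DS D I N Z"
    and fin: "finite I" and k: "k \<in> I"
    and S: "(\<lambda>(d, z). S d z) \<in> borel_measurable (DS \<Otimes>\<^sub>M N)"
    and C: "C \<in> sets DS" and u: "u \<in> borel_measurable DS"
    and u0: "\<And>d. d \<in> C \<Longrightarrow> 0 \<le> u d"
  defines "R \<equiv> \<lambda>j d z. real (card {i\<in>I. S d (z i) \<ge> S d (z j)})"
  shows "{\<omega>\<in>space M. D \<omega> \<in> C \<and> R k (D \<omega>) (\<lambda>i. Z i \<omega>) \<le> real (card I) * u (D \<omega>)} \<in> sets M" (is "?G k \<in> _")
    and "emeasure M {\<omega>\<in>space M. D \<omega> \<in> C \<and> R k (D \<omega>) (\<lambda>i. Z i \<omega>) \<le> real (card I) * u (D \<omega>)}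
      \<le> (\<integral>\<^sup>+\<omega>. ennreal (u (D \<omega>)) * indicator C (D \<omega>) \<partial>M)"
proof -
  interpret prob_space M by fact
  let ?Q = "PiM I (\<lambda>_. N)"
  let ?P = "DS \<Otimes>\<^sub>M ?Q"
  let ?n = "real (card I)"
  let ?B = "\<lambda>j. {p\<in>space ?P. fst p \<in> C \<and> R j (fst p) (snd p) \<le> ?n * u (fst p)}"
  note [measurable] = D C u
  have S'[measurable]: "(\<lambda>p. S (fst p) (snd p i)) \<in> borel_measurable ?P" if "i \<in> I" for i
  proof -
    have "(\<lambda>p. (fst p, snd p i)) \<in> ?P \<rightarrow>\<^sub>M DS \<Otimes>\<^sub>M N"
      using that by measurable
    from measurable_compose[OF this S] show ?thesis by simp
  qed
  \<comment> \<open>Written as a sum, the rank is visibly measurable and can be reindexed by a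
    permutation.\<close>
  have R_sum: "R j d z = (\<Sum>i\<in>I. if S d (z i) \<ge> S d (z j) then 1 else 0)" for j d z
    unfolding R_def using fin by (simp add: sum.If_cases Int_def)
  have B[measurable]: "?B j \<in> sets ?P" if "j \<in> I" for j
  proof -
    have "(\<lambda>p. R j (fst p) (snd p)) \<in> borel_measurable ?P"
      unfolding R_sum by (intro borel_measurable_sum measurable_If borel_measurable_const
        borel_measurable_le S' that)
    note [measurable] = this
    show ?thesis by measurable
  qed
  have ZQ: "(\<lambda>\<omega>. \<lambda>i\<in>I. Z (\<rho> i) \<omega>) \<in> M \<rightarrow>\<^sub>M ?Q" if "\<rho> permutes I" for \<rho>
    using that Z permutes_in_image[OF that] by (intro measurable_restrict) auto
  have joint: "(\<lambda>\<omega>. (D \<omega>, \<lambda>i\<in>I. Z (\<rho> i) \<omega>)) \<in> M \<rightarrow>\<^sub>M ?P" if "\<rho> permutes I" for \<rho>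
    using ZQ[OF that] by measurable
  \<comment> \<open>Ranks are equivariant: in the family permuted by \<open>\<rho>\<close>, position
    \<open>j\<close> holds document \<open>\<rho> j\<close>, whose rank is unchanged because the
    pool it is compared with is the same set of documents.\<close>
  have pre: "(\<lambda>\<omega>. (D \<omega>, \<lambda>i\<in>I. Z (\<rho> i) \<omega>)) -` ?B j \<inter> space M = ?G (\<rho> j)"
    if \<rho>: "\<rho> permutes I" and j: "j \<in> I" for \<rho> j
  proof -
    have "R j d (\<lambda>i\<in>I. Z (\<rho> i) \<omega>) = R (\<rho> j) d (\<lambda>i. Z i \<omega>)" for d \<omega>
    proof -
      have "R (\<rho> j) d (\<lambda>i. Z i \<omega>) = (\<Sum>i\<in>I. if S d (Z (\<rho> i) \<omega>) \<ge> S d (Z (\<rho> j) \<omega>) then 1 else 0)"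
        unfolding R_sum by (rule sum.permute[OF \<rho>, unfolded comp_def])
      also have "\<dots> = R j d (\<lambda>i\<in>I. Z (\<rho> i) \<omega>)"
        unfolding R_sum using j by (intro sum.cong) auto
      finally show ?thesis ..
    qed
    then show ?thesis
      using measurable_space[OF joint[OF \<rho>]] by auto
  qed
  have G: "?G j \<in> sets M" if "j \<in> I" for j
    using measurable_sets[OF joint[OF permutes_id] B[OF that]] pre[OF permutes_id that] by simp
  then show "?G k \<in> sets M" using k .
  have eq: "emeasure M (?G j) = emeasure M (?G k)" if j: "j \<in> I" for j
  proof -
    \<comment> \<open>The transposition sends \<open>k\<close> to \<open>j\<close>, so the one set
      \<open>?B k\<close> pulls back to \<open>?G j\<close> along the permuted family and to
      \<open>?G k\<close> along the original one.\<close>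
    let ?\<tau> = "Transposition.transpose k j"
    have \<tau>: "?\<tau> permutes I" using j k by (rule permutes_swap_id[rotated])
    have "emeasure M (?G j) = emeasure (distr M ?P (\<lambda>\<omega>. (D \<omega>, \<lambda>i\<in>I. Z (?\<tau> i) \<omega>))) (?B k)"
      using emeasure_distr[OF joint[OF \<tau>] B[OF k]] pre[OF \<tau> k] by simp
    also have "\<dots> = emeasure (distr M ?P (\<lambda>\<omega>. (D \<omega>, \<lambda>i\<in>I. Z i \<omega>))) (?B k)"
      by (simp only: cond_exchangeable_joint_law[OF M D Z ex \<tau>])
    also have "\<dots> = emeasure M (?G k)"
      using emeasure_distr[OF joint[OF permutes_id] B[OF k]] pre[OF permutes_id k] by simp
    finally show ?thesis .
  qed
  \<comment> \<open>Averaging: equal probabilities turn the single event into a sum over all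
    documents, and under the integral that sum is the number of documents of small rank.\<close>
  have "of_nat (card I) * emeasure M (?G k) = (\<Sum>j\<in>I. emeasure M (?G j))"
    using eq by simp
  also have "\<dots> = (\<Sum>j\<in>I. \<integral>\<^sup>+\<omega>. indicator (?G j) \<omega> \<partial>M)"
    using G by (intro sum.cong) auto
  also have "\<dots> = (\<integral>\<^sup>+\<omega>. (\<Sum>j\<in>I. indicator (?G j) \<omega>) \<partial>M)"
    using G by (intro nn_integral_sum[symmetric]) auto
  also have "\<dots> \<le> (\<integral>\<^sup>+\<omega>. of_nat (card I) * (ennreal (u (D \<omega>)) * indicator C (D \<omega>)) \<partial>M)"
  proof (rule nn_integral_mono)
    fix \<omega> assume \<omega>: "\<omega> \<in> space M"
    show "(\<Sum>j\<in>I. indicator (?G j) \<omega>) \<le> of_nat (card I) * (ennreal (u (D \<omega>)) * indicator C (D \<omega>))"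
    proof (cases "D \<omega> \<in> C")
      case True
      let ?J = "{j\<in>I. R j (D \<omega>) (\<lambda>i. Z i \<omega>) \<le> ?n * u (D \<omega>)}"
      have "(\<Sum>j\<in>I. indicator (?G j) \<omega>) = (\<Sum>j\<in>I. if R j (D \<omega>) (\<lambda>i. Z i \<omega>) \<le> ?n * u (D \<omega>) then 1 else 0 :: ennreal)"
        using True \<omega> by (intro sum.cong) auto
      also have "\<dots> = ennreal (real (card ?J))"
        using fin by (simp add: sum.If_cases Int_def ennreal_of_nat_eq_real_of_nat)
      also have "\<dots> \<le> ennreal (?n * u (D \<omega>))"
        unfolding R_def using fin u0[OF True] by (intro ennreal_leI card_small_rank_le) auto
      finally show ?thesis
        using True u0[OF True] by (simp add: ennreal_mult ennreal_of_nat_eq_real_of_nat)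
    qed simp
  qed
  also have "\<dots> = of_nat (card I) * (\<integral>\<^sup>+\<omega>. ennreal (u (D \<omega>)) * indicator C (D \<omega>) \<partial>M)"
    by (intro nn_integral_cmult) measurable
  finally have le: "of_nat (card I) * emeasure M (?G k)
      \<le> of_nat (card I) * (\<integral>\<^sup>+\<omega>. ennreal (u (D \<omega>)) * indicator C (D \<omega>) \<partial>M)" .
  \<comment> \<open>Cancelling in \<open>ennreal\<close> needs a factor that is neither zero nor
    infinite.\<close>
  have "card I \<noteq> 0" using fin k by auto
  then show "emeasure M (?G k) \<le> (\<integral>\<^sup>+\<omega>. ennreal (u (D \<omega>)) * indicator C (D \<omega>) \<partial>M)"
    using le by (subst (asm) ennreal_mult_le_mult_iff) auto
qed

text \<open>The \<open>1 +\<close> in the numerator of the p-value is the new document compared with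
  itself, that is, the term of index 0 in the pool.\<close>

lemma conformal_p_eq_rank:
  "conformal_p m s (\<lambda>i. H i \<omega>) (X \<omega>)
     = real (card {i\<in>{0..m}. s (pooled H X i \<omega>) \<ge> s (pooled H X 0 \<omega>)}) / real (card {0..m})"
proof -
  have "real (card {i\<in>{0..m}. s (pooled H X i \<omega>) \<ge> s (pooled H X 0 \<omega>)})
      = (\<Sum>i=0..m. of_bool (s (pooled H X i \<omega>) \<ge> s (pooled H X 0 \<omega>)))"
    by (simp add: Int_def)
  also have "\<dots> = 1 + (\<Sum>i=1..m. of_bool (s (pooled H X i \<omega>) \<ge> s (pooled H X 0 \<omega>)))"
    by (simp add: sum.atLeast_Suc_atMost del: sum_of_bool_eq)
  also have "\<dots> = 1 + (\<Sum>i=1..m. of_bool (s (H i \<omega>) \<ge> s (X \<omega>)))"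
    by (intro arg_cong2[where f = "(+)"] sum.cong refl) (auto simp: pooled_def)
  finally show ?thesis by (simp add: conformal_p_def add.commute)
qed

theorem theorem4p1:
  fixes M :: "'w measure"
    and DS :: "'d measure" and Dev :: "'w \<Rightarrow> 'd"
    and N :: "('tok, 'meta) doc measure" and V :: "'seed measure"
    and H :: "nat \<Rightarrow> 'w \<Rightarrow> ('tok, 'meta, 'seed) aug_doc"
    and X :: "'w \<Rightarrow> ('tok, 'meta, 'seed) aug_doc"
    and A :: "'d \<Rightarrow> action set"
    and b :: "'d \<Rightarrow> nat \<Rightarrow> nat"
    and g :: "'d \<Rightarrow> action \<Rightarrow> 'tok list \<Rightarrow> 'meta \<Rightarrow> 'seed \<Rightarrow> ereal"
    and w :: "'d \<Rightarrow> action \<Rightarrow> real"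
    and executed :: "'w \<Rightarrow> action list"
    and \<alpha> :: real and m :: nat
  assumes alpha: "0 < \<alpha>" "\<alpha> < 1"
    and m: "m \<ge> 1"
    and null_experiment: "prob_space M"
    and dev: "Dev \<in> M \<rightarrow>\<^sub>M DS"
    and calibration: "\<And>i. i \<in> {1..m} \<Longrightarrow> H i \<in> M \<rightarrow>\<^sub>M (N \<Otimes>\<^sub>M V)"
    and test: "X \<in> M \<rightarrow>\<^sub>M (N \<Otimes>\<^sub>M V)"
    and exch: "cond_exchangeable M DS Dev {0..m} (N \<Otimes>\<^sub>M V) (pooled H X)"
    and family_meas: "\<And>a. {d \<in> space DS. a \<in> A d} \<in> sets DS"
    and family_finite: "\<And>d. d \<in> space DS \<Longrightarrow> finite (A d)"
    and score_meas:
      "\<And>a. (\<lambda>(d, z). score (b d) (g d) a z) \<in> borel_measurable (DS \<Otimes>\<^sub>M (N \<Otimes>\<^sub>M V))"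
    and weight_meas: "\<And>a. (\<lambda>d. w d a) \<in> borel_measurable DS"
    and weight_nonneg: "\<And>d a. d \<in> space DS \<Longrightarrow> a \<in> A d \<Longrightarrow> w d a \<ge> 0"
    and weight_sum: "\<And>d. d \<in> space DS \<Longrightarrow> (\<Sum>a\<in>A d. w d a) \<le> 1"
    and executed_meas: "executed \<in> M \<rightarrow>\<^sub>M count_space UNIV"
    and executed_family: "\<And>\<omega>. \<omega> \<in> space M \<Longrightarrow> set (executed \<omega>) \<subseteq> A (Dev \<omega>)"
  shows "measure M {\<omega> \<in> space M. \<exists>a \<in> set (executed \<omega>).
            conformal_p m (score (b (Dev \<omega>)) (g (Dev \<omega>)) a) (\<lambda>i. H i \<omega>) (X \<omega>)
              \<le> \<alpha> * w (Dev \<omega>) a} \<le> \<alpha>"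
proof -
  interpret prob_space M by fact
  let ?S = "\<lambda>a d. score (b d) (g d) a"
  let ?C = "\<lambda>a. {d\<in>space DS. a \<in> A d}"
  let ?u = "\<lambda>a d. \<alpha> * w d a"
  let ?p = "\<lambda>a \<omega>. conformal_p m (?S a (Dev \<omega>)) (\<lambda>i. H i \<omega>) (X \<omega>)"
  let ?G = "\<lambda>a. {\<omega>\<in>space M. Dev \<omega> \<in> ?C a \<and> ?p a \<omega> \<le> ?u a (Dev \<omega>)}"
  let ?h = "\<lambda>a \<omega>. ennreal (?u a (Dev \<omega>)) * indicator (?C a) (Dev \<omega>)"
  \<comment> \<open>A bijection from the naturals onto all pairs, so that a series over
    \<open>n\<close> runs once through every possible action; the indicator in \<open>?h\<close>
    removes those outside the family.\<close>
  let ?e = "prod_decode"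
  have Z: "pooled H X i \<in> M \<rightarrow>\<^sub>M (N \<Otimes>\<^sub>M V)" if "i \<in> {0..m}" for i
    using that calibration[of i] test by (auto simp: pooled_def)
  have u_nonneg: "0 \<le> ?u a d" if "d \<in> ?C a" for a d
    using that alpha weight_nonneg by auto
  have u_meas: "?u a \<in> borel_measurable DS" for a
    using weight_meas by measurable
  have G_eq: "?G a = {\<omega>\<in>space M. Dev \<omega> \<in> ?C a \<and>
      real (card {i\<in>{0..m}. ?S a (Dev \<omega>) (pooled H X i \<omega>) \<ge> ?S a (Dev \<omega>) (pooled H X 0 \<omega>)})
        \<le> real (card {0..m}) * ?u a (Dev \<omega>)}" for a
    unfolding conformal_p_eq_rank
    by (intro Collect_cong conj_cong refl, subst pos_divide_le_eq) (simp_all add: mult.commute)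
  note rank = exchangeable_rank_bound[OF null_experiment dev Z exch finite_atLeastAtMost _
      score_meas family_meas u_meas u_nonneg, where k = 0]
  have G: "?G a \<in> sets M" and G_le: "emeasure M (?G a) \<le> (\<integral>\<^sup>+\<omega>. ?h a \<omega> \<partial>M)" for a
    unfolding G_eq by (rule rank; simp)+
  have [measurable]: "?h a \<in> borel_measurable M" for a
    using dev family_meas[of a] u_meas[of a] by measurable
  \<comment> \<open>For fixed development information the series has finitely many nonzero terms and
    equals \<alpha> times the total weight of the family.\<close>
  have h_le: "(\<Sum>n. ?h (?e n) \<omega>) \<le> ennreal \<alpha>" if \<omega>: "\<omega> \<in> space M" for \<omega>
  proof -
    let ?d = "Dev \<omega>"
    have d: "?d \<in> space DS" using measurable_space[OF dev \<omega>] .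
    have bij: "bij_betw ?e (?e -` A ?d) (A ?d)"
      by (metis bij_betw_def bij_prod_decode inj_on_subset subset_UNIV surj_image_vimage_eq)
    have fin: "finite (?e -` A ?d)"
      using family_finite[OF d] bij_betw_finite[OF bij] by simp
    have "(\<Sum>n. ?h (?e n) \<omega>) = (\<Sum>n\<in>?e -` A ?d. ?h (?e n) \<omega>)"
      by (rule suminf_finite[OF fin]) auto
    also have "\<dots> = (\<Sum>a\<in>A ?d. ?h a \<omega>)"
      by (rule sum.reindex_bij_betw[OF bij])
    also have "\<dots> = (\<Sum>a\<in>A ?d. ennreal (?u a ?d))"
      using d by (intro sum.cong) auto
    also have "\<dots> = ennreal (\<alpha> * (\<Sum>a\<in>A ?d. w ?d a))"
      using u_nonneg d by (simp add: sum_ennreal sum_distrib_left)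
    also have "\<dots> \<le> ennreal \<alpha>"
      using alpha mult_left_mono[OF weight_sum[OF d], of \<alpha>] by (intro ennreal_leI) simp
    finally show ?thesis .
  qed
  let ?E = "{\<omega> \<in> space M. \<exists>a \<in> set (executed \<omega>). ?p a \<omega> \<le> ?u a (Dev \<omega>)}"
  \<comment> \<open>The execution rule enters through \<open>executed_family\<close>: whichever
    action raised the alert, it belongs to the family, so its event \<open>?G a\<close>
    occurs.\<close>
  have "?E \<subseteq> (\<Union>n. ?G (?e n))"
  proof
    fix \<omega> assume "\<omega> \<in> ?E"
    then obtain a where "\<omega> \<in> ?G a"
      using executed_family measurable_space[OF dev] by blast
    then have "\<omega> \<in> ?G (?e (prod_encode a))" by simp
    then show "\<omega> \<in> (\<Union>n. ?G (?e n))" by blast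
  qed
  then have "emeasure M ?E \<le> emeasure M (\<Union>n. ?G (?e n))"
    by (rule emeasure_mono) (intro sets.countable_UN image_subsetI G)
  also have "\<dots> \<le> (\<Sum>n. emeasure M (?G (?e n)))"
    by (intro emeasure_subadditive_countably image_subsetI G)
  also have "\<dots> \<le> (\<Sum>n. \<integral>\<^sup>+\<omega>. ?h (?e n) \<omega> \<partial>M)"
    by (intro suminf_le G_le) auto
  \<comment> \<open>The weights sum to at most 1 for each value of the development information, so
    the series has to be moved inside the integral before \<open>h_le\<close> applies.\<close>
  also have "\<dots> = (\<integral>\<^sup>+\<omega>. (\<Sum>n. ?h (?e n) \<omega>) \<partial>M)"
    by (intro nn_integral_suminf[symmetric]) measurable
  also have "\<dots> \<le> (\<integral>\<^sup>+\<omega>. ennreal \<alpha> \<partial>M)"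
    by (intro nn_integral_mono h_le)
  also have "\<dots> = ennreal \<alpha>" by (simp add: emeasure_space_1)
  finally show ?thesis
    using alpha by (simp add: emeasure_eq_measure)
qed

end
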